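(* For every integer $m\ge 0$, $$F_{m+3}=\sum_{i=0}^{\lfloor (m+1)/2\rfloor}\binom{m-i,\,1}{i}.$$
   Context: For nonnegative integers $m,n,k$, let $X$ be a set that is the disjoint union of blocks $X_1,\dots,X_n,Y$ with $|X_i|=2$ for $i=1,\dots,n$ and $|Y|=m$. The number $\binom{m,n}{k}$ is defined as the number of $(n+k)$-element subsets of $X$ that intersect each block $X_i$, $i=1,\dots,n$ (such subsets are called $(n+k)$-insets of $X$). $F_j$ denotes the $j$-th Fibonacci number, with $F_1=F_2=1$ and $F_{j+2}=F_{j+1}+F_j$. *)

theory Defs
  imports "HOL-Number_Theory.Fib" "HOL-Library.Disjoint_Sets"
begin

definition block_system :: "(nat \<Rightarrow> 'a set) \<Rightarrow> nat \<Rightarrow> 'a set \<Rightarrow> nat \<Rightarrow> bool" where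
  "block_system B n Y m \<longleftrightarrow>
     disjoint_family_on B {..<n} \<and> (\<forall>i<n. card (B i) = 2) \<and>
     finite Y \<and> card Y = m \<and> (\<forall>i<n. B i \<inter> Y = {})"

definition insets :: "(nat \<Rightarrow> 'a set) \<Rightarrow> nat \<Rightarrow> 'a set \<Rightarrow> nat \<Rightarrow> 'a set set" where
  "insets B n Y k =
     {S. S \<subseteq> (\<Union>i<n. B i) \<union> Y \<and> card S = n + k \<and> (\<forall>i<n. S \<inter> B i \<noteq> {})}"

definition std_block :: "nat \<Rightarrow> (nat \<times> bool + nat) set" where
  "std_block i = {Inl (i, False), Inl (i, True)}"

definition std_rest :: "nat \<Rightarrow> (nat \<times> bool + nat) set" where
  "std_rest m = Inr ` {..<m}"

text \<open>The number of insets depends only on the block sizes (\<open>card_insets\<close> below), so it is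
  defined by counting in one concrete block system.\<close>

definition inset_number :: "nat \<Rightarrow> nat \<Rightarrow> nat \<Rightarrow> nat" where
  "inset_number m n k = card (insets std_block n (std_rest m) k)"

lemma block_system_std: "block_system std_block n (std_rest m) m"
  by (auto simp: block_system_def std_block_def std_rest_def disjoint_family_on_def card_image)

lemma card_insets:
  assumes "block_system B n Y m"
  shows "card (insets B n Y k) = inset_number m n k"
proof -
  have disj: "\<And>i j. i < n \<Longrightarrow> j < n \<Longrightarrow> i \<noteq> j \<Longrightarrow> B i \<inter> B j = {}"
    and two: "\<And>i. i < n \<Longrightarrow> card (B i) = 2"
    and Y: "finite Y" "card Y = m" "\<And>i. i < n \<Longrightarrow> B i \<inter> Y = {}"
    using assms by (auto simp: block_system_def disjoint_family_on_def)
  have "\<forall>i. \<exists>x y. i < n \<longrightarrow> B i = {x, y} \<and> x \<noteq> y"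
    using two by (auto simp: card_2_iff)
  then obtain x y where xy: "\<And>i. i < n \<Longrightarrow> B i = {x i, y i}" "\<And>i. i < n \<Longrightarrow> x i \<noteq> y i"
    by metis
  obtain g where g: "bij_betw g {..<m} Y"
    using ex_bij_betw_nat_finite[OF Y(1)] Y(2) by (auto simp: atLeast0LessThan)
  define h where "h = case_sum (\<lambda>(i, b). if b then y i else x i) g"
  let ?X = "(\<Union>i<n. std_block i) \<union> std_rest m"
  have hB: "h ` std_block i = B i" if "i < n" for i
    using xy(1)[OF that] by (auto simp: h_def std_block_def)
  have hY: "h ` std_rest m = Y"
    using g by (auto simp: h_def std_rest_def image_image bij_betw_def)
  have hX: "h ` ?X = (\<Union>i<n. B i) \<union> Y"
    using hB hY by (simp add: image_Un image_UN)
  have gY: "g j \<in> Y" if "j < m" for j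
    using g that by (auto simp: bij_betw_def)
  have ginj: "j = j'" if "j < m" "j' < m" "g j = g j'" for j j'
    using g that by (auto simp: bij_betw_def inj_on_def)
  have blk: "(if b then y i else x i) \<in> B i" if "i < n" for i b
    using xy(1)[OF that] by auto
  have inl: "i = j \<and> b = c"
    if "i < n" "j < n" "(if b then y i else x i) = (if c then y j else x j)" for i j b c
  proof -
    have "i = j" using blk[OF that(1), of b] blk[OF that(2), of c] that disj[of i j] by auto
    then show ?thesis using that(3) xy(2)[OF that(1)] by (cases b; cases c) auto
  qed
  have mix: "(if b then y i else x i) \<noteq> g j" if "i < n" "j < m" for i b j
    using blk[OF that(1), of b] gY[OF that(2)] Y(3)[OF that(1)] by force
  have X_cases: "(\<exists>i b. i < n \<and> u = Inl (i, b)) \<or> (\<exists>j<m. u = Inr j)" if "u \<in> ?X" for u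
    using that by (auto simp: std_block_def std_rest_def)
  have h_simps: "h (Inl (i, b)) = (if b then y i else x i)" "h (Inr j) = g j" for i b j
    by (simp_all add: h_def)
  have inj: "inj_on h ?X"
  proof (rule inj_onI)
    fix u v
    assume uv: "u \<in> ?X" "v \<in> ?X" and eq: "h u = h v"
    from X_cases[OF uv(1)] show "u = v"
    proof (elim disjE exE conjE)
      fix i b assume u: "i < n" "u = Inl (i, b)"
      from X_cases[OF uv(2)] show ?thesis
      proof (elim disjE exE conjE)
        fix j c assume v: "j < n" "v = Inl (j, c)"
        show ?thesis using inl[OF u(1) v(1), of b c] eq unfolding u(2) v(2) h_simps by blast
      next
        fix j assume v: "j < m" "v = Inr j"
        show ?thesis using mix[OF u(1) v(1), of b] eq unfolding u(2) v(2) h_simps by blast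
      qed
    next
      fix i assume u: "i < m" "u = Inr i"
      from X_cases[OF uv(2)] show ?thesis
      proof (elim disjE exE conjE)
        fix j c assume v: "j < n" "v = Inl (j, c)"
        show ?thesis using mix[OF v(1) u(1), of c] eq[symmetric] unfolding u(2) v(2) h_simps by blast
      next
        fix j assume v: "j < m" "v = Inr j"
        show ?thesis using ginj[OF u(1) v(1)] eq unfolding u(2) v(2) h_simps by blast
      qed
    qed
  qed
  have img: "h ` S \<in> insets B n Y k \<longleftrightarrow> S \<in> insets std_block n (std_rest m) k"
    if S: "S \<subseteq> ?X" for S
  proof -
    have "card (h ` S) = card S"
      using inj S by (meson card_image inj_on_subset)
    moreover have "h ` S \<inter> B i = h ` (S \<inter> std_block i)" if "i < n" for i
    proof -
      have "std_block i \<subseteq> ?X" using that by auto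
      then show ?thesis using inj_on_image_Int[OF inj S] hB[OF that] by metis
    qed
    moreover have "h ` S \<subseteq> (\<Union>i<n. B i) \<union> Y"
      using S hX by blast
    ultimately show ?thesis using S by (auto simp: insets_def)
  qed
  have sub: "insets std_block n (std_rest m) k \<subseteq> Pow ?X"
    by (auto simp: insets_def)
  have "insets B n Y k = (`) h ` insets std_block n (std_rest m) k"
  proof (intro equalityI subsetI)
    fix T assume T: "T \<in> insets B n Y k"
    then have "T \<subseteq> h ` ?X" unfolding hX by (simp add: insets_def)
    then obtain S where "S \<subseteq> ?X" "T = h ` S" by (auto simp only: subset_image_iff)
    then show "T \<in> (`) h ` insets std_block n (std_rest m) k" using img T by blast
  next
    fix T assume "T \<in> (`) h ` insets std_block n (std_rest m) k"
    then show "T \<in> insets B n Y k" using img sub by blast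
  qed
  moreover have "inj_on ((`) h) (insets std_block n (std_rest m) k)"
    using inj_on_image_Pow[OF inj] sub by (rule inj_on_subset)
  ultimately show ?thesis by (simp add: inset_number_def card_image)
qed

end

theory Submission
  imports Defs
begin

text \<open>
  With a single two-element block, an inset is a subset of an \<open>(m + 2)\<close>-element set that is not
  contained in the rest \<open>Y\<close>. Hence there are \<open>(m + 2 choose k + 1) - (m choose k + 1)\<close> of them, and
  by Pascal's rule, applied twice, this difference is \<open>(m + 1 choose k) + (m choose k)\<close>
  (\<open>inset_number_one_block\<close>). Replacing \<open>m\<close> by \<open>m - i\<close> and \<open>k\<close> by \<open>i\<close>, the two summands run along
  two neighbouring shallow diagonals of Pascal's triangle, whose sums are \<open>fib (m + 2)\<close> and
  \<open>fib (m + 1)\<close>; these add up to \<open>fib (m + 3)\<close>.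
\<close>

lemma inset_number_one_block:
  "inset_number m 1 k = (Suc m choose k) + (m choose k)"
proof -
  let ?B = "std_block 0" and ?Y = "std_rest m"
  have fin: "finite ?B" "finite ?Y"
    by (simp_all add: std_block_def std_rest_def)
  have "card ?B = 2" "card ?Y = m" "?B \<inter> ?Y = {}"
    using block_system_std[of 1 m] by (simp_all add: block_system_def)
  then have card_all: "card (?B \<union> ?Y) = Suc (Suc m)"
    using fin by (simp add: card_Un_disjoint)
  have "insets std_block 1 ?Y k =
      {S. S \<subseteq> ?B \<union> ?Y \<and> card S = Suc k} - {S. S \<subseteq> ?Y \<and> card S = Suc k}"
    using \<open>?B \<inter> ?Y = {}\<close> by (auto simp: insets_def)
  also have "card \<dots> =
      card {S. S \<subseteq> ?B \<union> ?Y \<and> card S = Suc k} - card {S. S \<subseteq> ?Y \<and> card S = Suc k}"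
    using fin by (intro card_Diff_subset) auto
  also have "\<dots> = (Suc (Suc m) choose Suc k) - (m choose Suc k)"
    using fin card_all \<open>card ?Y = m\<close> by (simp add: n_subsets)
  also have "\<dots> = (Suc m choose k) + (m choose k)"
    by simp
  finally show ?thesis
    by (simp add: inset_number_def)
qed

text \<open>The entries of a shallow diagonal vanish past its midpoint, so its sum may be cut off at any
  bound from there on.\<close>

lemma sum_choose_diagonal_fib_truncated:
  assumes "n \<le> 2 * b + 1" and "b \<le> n"
  shows "(\<Sum>i = 0..b. (n - i) choose i) = fib (Suc n)"
proof -
  have "(\<Sum>i = 0..b. (n - i) choose i) = (\<Sum>i = 0..n. (n - i) choose i)"
    using assms by (intro sum.mono_neutral_left) (auto simp: binomial_eq_0_iff)
  also have "\<dots> = fib (Suc n)"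
    by (rule ne_diagonal_fib)
  finally show ?thesis .
qed

theorem corollary1:
  fixes m :: nat
  shows "fib (m + 3) = (\<Sum>i = 0..(m + 1) div 2. inset_number (m - i) 1 i)"
proof -
  let ?b = "(m + 1) div 2"
  \<comment> \<open>Since \<open>?b \<le> m\<close>, the difference \<open>m - i\<close> is never truncated, not even for \<open>m = 0\<close>.\<close>
  have b: "?b \<le> m"
    by (cases m) auto
  have "(\<Sum>i = 0..?b. inset_number (m - i) 1 i) =
      (\<Sum>i = 0..?b. ((Suc m - i) choose i) + ((m - i) choose i))"
    using b by (intro sum.cong) (auto simp: inset_number_one_block[unfolded One_nat_def] Suc_diff_le)
  also have "\<dots> = fib (Suc (Suc m)) + fib (Suc m)"
    using b by (simp add: sum.distrib sum_choose_diagonal_fib_truncated)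
  also have "\<dots> = fib (m + 3)"
    by (simp add: numeral_3_eq_3)
  finally show ?thesis ..
qed

end
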